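(* For a $(\mathbf{0,1})$-homogeneous ideal $I\subset h_{(\mathbf{0,1})}(D)$, $\mathcal{E}(I,\mathcal{W}_{\mathrm{loc}}')=\mathcal{E}(h_{(\mathbf{0,1})}(D_{\{0\}})\, I,\mathcal{W}_{\mathrm{loc}}')$.
   Context: Fix $n\ge 1$, a field $\mathbf{k}$ and $x=(x_1,\dots,x_n)$. $\mathbf{k}[x]_0$ is the localization of $\mathbf{k}[x]$ at $0\in\mathbf{k}^n$. $h_{(\mathbf{0,1})}(D)$ (resp. $h_{(\mathbf{0,1})}(D_{\{0\}})$) is the $\mathbf{k}$-algebra generated by $\mathbf{k}[x]$ (resp. $\mathbf{k}[x]_0$), $\partial_1,\dots,\partial_n$ and a variable $h$, with $\partial_i c(x)-c(x)\partial_i=\frac{\partial c(x)}{\partial x_i}h$ as the only nontrivial commutation relations. Each element is uniquely written $P=\sum c_{\alpha,\beta,k}x^\alpha\partial^\beta h^k$; $\mathrm{Supp}(P)$ is the set of $(\alpha,\beta,k)$ with nonzero coefficient; $P$ is ($(\mathbf{0,1})$-)homogeneous if $|\beta|+k$ is constant on $\mathrm{Supp}(P)$. Ideals are left ideals; an ideal is $(\mathbf{0,1})$-homogeneous if generated by homogeneous elements. $\mathcal{W}_{\mathrm{loc}}'=\{w=(u,v)\in\mathbb{R}^{2n}:u_i<0,\ u_i+v_i>0\ \forall i\}$. For $A$ one of the two rings, $\mathrm{ord}^w(P)=\max\{u\cdot\alpha+v\cdot\beta:(\alpha,\beta,k)\in\mathrm{Supp}(P)\}$, $F^w_m=\{P\in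 A:\mathrm{ord}^w(P)\le m\}$, $\mathrm{gr}^w(A)=\bigoplus_mF^w_m/F^w_{<m}$, $\mathrm{in}_w(P)$ is the class of $P$ in $F^w_m/F^w_{<m}$, $m=\mathrm{ord}^w(P)$ ($\mathrm{in}_w(0)=0$), and $\mathrm{in}_w(I)$ is the ideal of $\mathrm{gr}^w(A)$ generated by all $\mathrm{in}_w(P)$, $P\in I$. For $w\in\mathcal{W}_{\mathrm{loc}}'$ both graded rings are identified with the commutative ring $\mathbf{k}[x_1,\dots,x_n,\xi_1,\dots,\xi_n,h]$, $\xi_i$ being the class of $\partial_i$. For an ideal $I$ of one of these rings, $w\sim w'$ iff the corresponding graded rings are equal (automatic on $\mathcal{W}_{\mathrm{loc}}'$) and $\mathrm{in}_w(I)=\mathrm{in}_{w'}(I)$; $\mathcal{E}(I,\mathcal{W}_{\mathrm{loc}}')$ is the set of equivalence classes on $\mathcal{W}_{\mathrm{loc}}'$. *)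

theory Defs
  imports
    "HOL-Analysis.Finite_Cartesian_Product"
    "HOL-Library.Poly_Mapping"
    "HOL-Library.Product_Plus"
    "HOL-Computational_Algebra.Fraction_Field"
begin

section \<open>Polynomials, rational functions and the local ring at the origin\<close>

text \<open>
  The number of variables is the cardinality of the index type \<open>'n\<close>.  The linear order on
  \<open>'n\<close> (that of the variables \<open>x\<^sub>1, \<dots>, x\<^sub>n\<close>) is only there because the library needs one to
  know that polynomials form an integral domain.
\<close>

type_synonym 'n mono = "'n \<Rightarrow>\<^sub>0 nat"
type_synonym ('n, 'k) mpoly = "'n mono \<Rightarrow>\<^sub>0 'k"
type_synonym ('n, 'k) ratfun = "('n, 'k) mpoly fract"

abbreviation unit_mono :: "'n \<Rightarrow> 'n mono" where
  "unit_mono i \<equiv> Poly_Mapping.single i 1"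

definition mono_degree :: "'n::finite mono \<Rightarrow> nat" where
  "mono_degree \<beta> = (\<Sum>i\<in>UNIV. Poly_Mapping.lookup \<beta> i)"

text \<open>\<open>\<partial>p/\<partial>x\<^sub>i\<close>: its coefficient at \<open>x\<^sup>\<beta>\<close> is \<open>(\<beta>\<^sub>i + 1)\<close> times that of \<open>p\<close> at \<open>x\<^sup>\<beta> x\<^sub>i\<close>.\<close>

lift_definition mpoly_deriv :: "'n \<Rightarrow> ('n, 'k::comm_ring_1) mpoly \<Rightarrow> ('n, 'k) mpoly" is
  "\<lambda>i p \<beta>. of_nat (Poly_Mapping.lookup \<beta> i + 1) * p (\<beta> + unit_mono i)"
proof -
  fix i :: 'n and p :: "'n mono \<Rightarrow> 'k"
  assume fin: "finite {\<alpha>. p \<alpha> \<noteq> 0}"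
  have "inj (\<lambda>\<beta>. \<beta> + unit_mono i)"
    by (rule injI) simp
  then have "finite ((\<lambda>\<beta>. \<beta> + unit_mono i) -` {\<alpha>. p \<alpha> \<noteq> 0})"
    using fin by (rule finite_vimageI[rotated])
  then show "finite {\<beta>. of_nat (Poly_Mapping.lookup \<beta> i + 1) * p (\<beta> + unit_mono i) \<noteq> 0}"
    by (rule rev_finite_subset) auto
qed

lemma poly_mapping_sum_singles: "p = (\<Sum>a\<in>Poly_Mapping.keys p. Poly_Mapping.single a (Poly_Mapping.lookup p a))"
  by (rule poly_mapping_eqI)
     (auto simp: lookup_sum lookup_single when_def in_keys_iff sum.delta)

lemma poly_mapping_induct [case_names zero single add]:
  fixes p :: "'a \<Rightarrow>\<^sub>0 'b::comm_monoid_add"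
  assumes "P 0" "\<And>a b. P (Poly_Mapping.single a b)" "\<And>p q. P p \<Longrightarrow> P q \<Longrightarrow> P (p + q)"
  shows "P p"
proof -
  have "P (\<Sum>a\<in>A. Poly_Mapping.single a (Poly_Mapping.lookup p a))" if "finite A" for A
    using that by induction (auto intro: assms)
  then show ?thesis
    by (subst poly_mapping_sum_singles) simp
qed

lemma mpoly_deriv_zero [simp]: "mpoly_deriv i 0 = 0"
  by transfer simp

lemma mpoly_deriv_add: "mpoly_deriv i (p + q) = mpoly_deriv i p + mpoly_deriv i q"
  by transfer (auto simp: algebra_simps)

lemma mpoly_deriv_single:
  "mpoly_deriv i (Poly_Mapping.single \<alpha> c) =
     Poly_Mapping.single (\<alpha> - unit_mono i) (of_nat (Poly_Mapping.lookup \<alpha> i) * c)"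
proof (rule poly_mapping_eqI)
  fix \<beta>
  have *: "\<alpha> - unit_mono i + unit_mono i = \<alpha>" if "Poly_Mapping.lookup \<alpha> i \<noteq> 0"
    using that by (intro poly_mapping_eqI) (auto simp: lookup_add lookup_minus lookup_single when_def)
  show "Poly_Mapping.lookup (mpoly_deriv i (Poly_Mapping.single \<alpha> c)) \<beta> =
      Poly_Mapping.lookup (Poly_Mapping.single (\<alpha> - unit_mono i) (of_nat (Poly_Mapping.lookup \<alpha> i) * c)) \<beta>"
  proof (cases "\<alpha> = \<beta> + unit_mono i")
    case True
    then show ?thesis
      by (simp add: mpoly_deriv.rep_eq lookup_add)
  next
    case False
    then have "Poly_Mapping.lookup \<alpha> i = 0 \<or> \<alpha> - unit_mono i \<noteq> \<beta>"
      using * by auto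
    then show ?thesis
      using False by (auto simp: mpoly_deriv.rep_eq lookup_single)
  qed
qed

lemma mpoly_deriv_mult: "mpoly_deriv i (p * q) = mpoly_deriv i p * q + p * mpoly_deriv i q"
proof (induction p rule: poly_mapping_induct)
  case (single \<alpha> a)
  show ?case
  proof (induction q rule: poly_mapping_induct)
    case (single \<beta> b)
    have A: "\<alpha> + \<beta> - unit_mono i = \<alpha> - unit_mono i + \<beta>" if "Poly_Mapping.lookup \<alpha> i \<noteq> 0"
      using that by (intro poly_mapping_eqI) (auto simp: lookup_add lookup_minus lookup_single when_def)
    have B: "\<alpha> + \<beta> - unit_mono i = \<alpha> + (\<beta> - unit_mono i)" if "Poly_Mapping.lookup \<beta> i \<noteq> 0"
      using that by (intro poly_mapping_eqI) (auto simp: lookup_add lookup_minus lookup_single when_def)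
    show ?case
      using A B
      by (cases "Poly_Mapping.lookup \<alpha> i = 0"; cases "Poly_Mapping.lookup \<beta> i = 0")
         (simp_all add: mpoly_deriv_single mult_single lookup_add single_add[symmetric] algebra_simps)
  qed (simp_all add: mpoly_deriv_add algebra_simps)
qed (simp_all add: mpoly_deriv_add algebra_simps)

lemma mpoly_deriv_commute: "mpoly_deriv i (mpoly_deriv j p) = mpoly_deriv j (mpoly_deriv i p)"
  by (rule poly_mapping_eqI)
     (auto simp: mpoly_deriv.rep_eq lookup_add lookup_single when_def algebra_simps)

lift_definition ratfun_deriv ::
  "'n::linorder \<Rightarrow> ('n, 'k::field) ratfun \<Rightarrow> ('n, 'k) ratfun" is
  "\<lambda>i r. (mpoly_deriv i (fst r) * snd r - fst r * mpoly_deriv i (snd r), snd r * snd r)"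
proof -
  fix i :: 'n and r s :: "('n, 'k) mpoly \<times> ('n, 'k) mpoly"
  assume rs: "fractrel r s"
  obtain a b c d where [simp]: "r = (a, b)" "s = (c, d)"
    by (cases r, cases s)
  from rs have nz: "b \<noteq> 0" "d \<noteq> 0" and eq: "a * d = c * b"
    by auto
  define a' b' c' d' where
    "a' = mpoly_deriv i a" "b' = mpoly_deriv i b" "c' = mpoly_deriv i c" "d' = mpoly_deriv i d"
  have eq': "a' * d + a * d' = c' * b + c * b'"
    using arg_cong[OF eq, of "mpoly_deriv i"] by (simp add: mpoly_deriv_mult a'_b'_c'_d'_def)
  have "(a' * b - a * b') * (d * d) = (a' * d) * b * d - (a * d) * d * b'"
    by (simp add: algebra_simps)
  also have "\<dots> = (c' * b + c * b' - a * d') * b * d - (c * b) * d * b'"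
    unfolding eq using eq' by (simp add: eq_diff_eq)
  also have "\<dots> = c' * d * (b * b) - (a * d) * d' * b"
    by (simp add: algebra_simps)
  also have "\<dots> = (c' * d - c * d') * (b * b)"
    unfolding eq by (simp add: algebra_simps)
  finally show "fractrel (mpoly_deriv i (fst r) * snd r - fst r * mpoly_deriv i (snd r), snd r * snd r)
      (mpoly_deriv i (fst s) * snd s - fst s * mpoly_deriv i (snd s), snd s * snd s)"
    using nz by (simp add: a'_b'_c'_d'_def)
qed

lemma ratfun_deriv_Fract:
  "g \<noteq> 0 \<Longrightarrow> ratfun_deriv i (Fract f g) = Fract (mpoly_deriv i f * g - f * mpoly_deriv i g) (g * g)"
  by transfer simp

lemma mpoly_deriv_one [simp]: "mpoly_deriv i 1 = 0"
  using mpoly_deriv_single[of i 0 1] by (simp flip: single_one)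

lemma mpoly_deriv_uminus: "mpoly_deriv i (- p) = - mpoly_deriv i p"
  by (rule poly_mapping_eqI) (simp add: mpoly_deriv.rep_eq)

lemma mpoly_deriv_diff: "mpoly_deriv i (p - q) = mpoly_deriv i p - mpoly_deriv i q"
  using mpoly_deriv_add[of i p "- q"] by (simp add: mpoly_deriv_uminus)

lemma ratfun_deriv_zero [simp]: "ratfun_deriv i 0 = 0"
  and ratfun_deriv_one [simp]: "ratfun_deriv i 1 = 0"
  by (simp_all add: Zero_fract_def One_fract_def ratfun_deriv_Fract eq_fract)

lemma ratfun_deriv_add: "ratfun_deriv i (r + s) = ratfun_deriv i r + ratfun_deriv i s"
  by (cases r, cases s)
     (simp add: ratfun_deriv_Fract eq_fract mpoly_deriv_add mpoly_deriv_mult algebra_simps)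

lemma ratfun_deriv_mult: "ratfun_deriv i (r * s) = ratfun_deriv i r * s + r * ratfun_deriv i s"
  by (cases r, cases s)
     (simp add: ratfun_deriv_Fract eq_fract mpoly_deriv_mult algebra_simps)

lemma ratfun_deriv_commute: "ratfun_deriv i (ratfun_deriv j r) = ratfun_deriv j (ratfun_deriv i r)"
  by (cases r)
     (simp add: ratfun_deriv_Fract eq_fract mpoly_deriv_mult mpoly_deriv_diff
        mpoly_deriv_commute[of i j] algebra_simps)

definition polynomials :: "('n::linorder, 'k::field) ratfun set" where
  "polynomials = {Fract f 1 | f. True}"

definition local_ring :: "('n::linorder, 'k::field) ratfun set" where
  "local_ring = {Fract f g | f g. Poly_Mapping.lookup g 0 \<noteq> 0}"


section \<open>Homogenized differential operators\<close>

text \<open>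
  An operator \<open>\<Sum> c\<^bsub>\<beta>,k\<^esub>(x) \<partial>\<^sup>\<beta> h\<^sup>k\<close> with coefficients in \<open>k(x)\<close> is stored as its family of
  coefficients.  The rings over \<open>k[x]\<close> and over its localization at \<open>0\<close> are the subrings
  \<open>hD\<close> and \<open>hD0\<close> of this ring; the lemmas \<open>hdel_hconst\<close>, \<open>hD_eq_hull\<close> and \<open>hD0_eq_hull\<close> give
  their presentation by generators and relations.
\<close>

typedef (overloaded) ('n::linorder, 'k::field) hdiff =
  "UNIV :: ('n mono \<times> nat \<Rightarrow>\<^sub>0 ('n, 'k) ratfun) set"
  morphisms coeffs Hdiff ..

setup_lifting type_definition_hdiff

text \<open>
  On coefficient families, viewed as polynomials in commuting variables \<open>\<partial>\<^sub>1, \<dots>, \<partial>\<^sub>n, h\<close> over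
  \<open>k(x)\<close>, left multiplication by \<open>c(x) h\<^sup>k\<close> is the commutative product, whereas by
  \<open>\<partial>\<^sub>i c = c \<partial>\<^sub>i + (\<partial>c/\<partial>x\<^sub>i) h\<close> left multiplication by \<open>\<partial>\<^sub>i\<close> is \<open>left_del i\<close>.
\<close>

definition coeff_deriv ::
  "'n::linorder \<Rightarrow> ('n mono \<times> nat \<Rightarrow>\<^sub>0 ('n, 'k::field) ratfun) \<Rightarrow> ('n mono \<times> nat \<Rightarrow>\<^sub>0 ('n, 'k) ratfun)" where
  "coeff_deriv i Q = Poly_Mapping.map (ratfun_deriv i) Q"

definition left_del ::
  "'n::linorder \<Rightarrow> ('n mono \<times> nat \<Rightarrow>\<^sub>0 ('n, 'k::field) ratfun) \<Rightarrow> ('n mono \<times> nat \<Rightarrow>\<^sub>0 ('n, 'k) ratfun)" where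
  "left_del i Q =
     Poly_Mapping.single (unit_mono i, 0) 1 * Q + Poly_Mapping.single (0, 1) 1 * coeff_deriv i Q"

definition left_del_mono ::
  "'n::{finite,linorder} mono \<Rightarrow> ('n mono \<times> nat \<Rightarrow>\<^sub>0 ('n, 'k::field) ratfun) \<Rightarrow>
     ('n mono \<times> nat \<Rightarrow>\<^sub>0 ('n, 'k) ratfun)" where
  "left_del_mono \<beta> Q =
     foldr (\<lambda>i. left_del i ^^ Poly_Mapping.lookup \<beta> i) (sorted_list_of_set UNIV) Q"

definition left_mult ::
  "('n::{finite,linorder} mono \<times> nat \<Rightarrow>\<^sub>0 ('n, 'k::field) ratfun) \<Rightarrow>
     ('n mono \<times> nat \<Rightarrow>\<^sub>0 ('n, 'k) ratfun) \<Rightarrow> ('n mono \<times> nat \<Rightarrow>\<^sub>0 ('n, 'k) ratfun)" where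
  "left_mult P Q =
     (\<Sum>(\<beta>, k)\<in>Poly_Mapping.keys P.
        Poly_Mapping.single (0, k) (Poly_Mapping.lookup P (\<beta>, k)) * left_del_mono \<beta> Q)"

lemma single_0_0_one [simp]: "Poly_Mapping.single (0, 0) 1 = 1"
  by (metis single_one zero_prod_def)

lemma coeff_deriv_lookup:
  "Poly_Mapping.lookup (coeff_deriv i Q) s = ratfun_deriv i (Poly_Mapping.lookup Q s)"
  by (simp add: coeff_deriv_def Poly_Mapping.map.rep_eq when_def)

lemma coeff_deriv_zero [simp]: "coeff_deriv i 0 = 0"
  by (rule poly_mapping_eqI) (simp add: coeff_deriv_lookup)

lemma coeff_deriv_add: "coeff_deriv i (P + Q) = coeff_deriv i P + coeff_deriv i Q"
  by (rule poly_mapping_eqI) (simp add: coeff_deriv_lookup lookup_add ratfun_deriv_add)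

lemma coeff_deriv_single:
  "coeff_deriv i (Poly_Mapping.single s c) = Poly_Mapping.single s (ratfun_deriv i c)"
  by (rule poly_mapping_eqI) (simp add: coeff_deriv_lookup lookup_single when_def)

lemma coeff_deriv_commute: "coeff_deriv i (coeff_deriv j P) = coeff_deriv j (coeff_deriv i P)"
  by (rule poly_mapping_eqI) (simp add: coeff_deriv_lookup ratfun_deriv_commute)

lemma coeff_deriv_mult: "coeff_deriv i (P * Q) = coeff_deriv i P * Q + P * coeff_deriv i Q"
proof (induction P rule: poly_mapping_induct)
  case (single a b)
  show ?case
    by (induction Q rule: poly_mapping_induct)
       (simp_all add: coeff_deriv_add coeff_deriv_single mult_single ratfun_deriv_mult
          single_add algebra_simps)
qed (simp_all add: coeff_deriv_add algebra_simps)

lemma left_del_zero [simp]: "left_del i 0 = 0"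
  by (simp add: left_del_def)

lemma left_del_add: "left_del i (P + Q) = left_del i P + left_del i Q"
  by (simp add: left_del_def coeff_deriv_add algebra_simps)

lemma left_del_commute: "left_del i (left_del j P) = left_del j (left_del i P)"
  by (simp add: left_del_def coeff_deriv_add coeff_deriv_mult coeff_deriv_single
      coeff_deriv_commute[of i j] algebra_simps)

lemma left_del_scale:
  "left_del i (Poly_Mapping.single (0, k) c * Q) =
     Poly_Mapping.single (0, k) c * left_del i Q +
     Poly_Mapping.single (0, Suc k) (ratfun_deriv i c) * Q"
proof -
  have *: "Poly_Mapping.single (0, Suc k) (ratfun_deriv i c) =
      Poly_Mapping.single (0, 1) 1 * Poly_Mapping.single (0, k) (ratfun_deriv i c)"
    by (simp add: mult_single)
  show ?thesis
    unfolding left_del_def coeff_deriv_mult coeff_deriv_single *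
    by (simp only: algebra_simps)
qed

lemma left_del_pow_commute:
  "left_del j ((left_del i ^^ m) P) = (left_del i ^^ m) (left_del j P)"
  by (induction m) (simp_all add: left_del_commute[of j i])

lemma foldr_left_del_unit:
  assumes "distinct is" "j \<in> set is"
  shows "foldr (\<lambda>i. left_del i ^^ Poly_Mapping.lookup (\<beta> + unit_mono j) i) is Q =
    left_del j (foldr (\<lambda>i. left_del i ^^ Poly_Mapping.lookup \<beta> i) is Q)"
  using assms
proof (induction "is")
  case (Cons a "is")
  show ?case
  proof (cases "a = j")
    case True
    with Cons.prems have "j \<notin> set is"
      by simp
    then have "foldr (\<lambda>i. left_del i ^^ Poly_Mapping.lookup (\<beta> + unit_mono j) i) is Q =
        foldr (\<lambda>i. left_del i ^^ Poly_Mapping.lookup \<beta> i) is Q"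
      by (intro foldr_cong) (auto simp: lookup_add lookup_single when_def)
    then show ?thesis
      using True by (simp add: lookup_add)
  next
    case False
    then show ?thesis
      using Cons by (simp add: lookup_add lookup_single left_del_pow_commute)
  qed
qed simp

lemma left_del_mono_unit: "left_del_mono (\<beta> + unit_mono i) Q = left_del i (left_del_mono \<beta> Q)"
  unfolding left_del_mono_def by (rule foldr_left_del_unit) simp_all

lemmas left_del_mono_unit' = left_del_mono_unit left_del_mono_unit[unfolded One_nat_def]

lemma left_del_mono_0 [simp]: "left_del_mono 0 Q = Q"
proof -
  have "foldr (\<lambda>i. left_del i ^^ 0) is Q = Q" for "is"
    by (induction "is") auto
  then show ?thesis
    by (simp add: left_del_mono_def)
qed

lemma left_del_mono_one: "left_del_mono (unit_mono i) Q = left_del i Q"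
  using left_del_mono_unit[of 0 i Q] by simp

lemma mono_induct [case_names zero unit]:
  fixes \<beta> :: "'n::finite mono"
  assumes "P 0" "\<And>\<beta> i. P \<beta> \<Longrightarrow> P (\<beta> + unit_mono i)"
  shows "P \<beta>"
proof (induction "mono_degree \<beta>" arbitrary: \<beta>)
  case 0
  then have "\<beta> = 0"
    by (intro poly_mapping_eqI) (simp add: mono_degree_def)
  then show ?case
    using assms by simp
next
  case (Suc d)
  then obtain i where i: "Poly_Mapping.lookup \<beta> i \<noteq> 0"
    by (metis mono_degree_def nat.distinct(1) sum.neutral)
  define \<gamma> where "\<gamma> = \<beta> - unit_mono i"
  have \<beta>: "\<beta> = \<gamma> + unit_mono i"
    using i unfolding \<gamma>_def
    by (intro poly_mapping_eqI) (auto simp: lookup_add lookup_minus lookup_single when_def)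
  have "mono_degree \<beta> = Suc (mono_degree \<gamma>)"
    by (simp add: mono_degree_def \<beta> lookup_add lookup_single when_def sum.distrib)
  then have "P \<gamma>"
    using Suc by simp
  then show ?case
    unfolding \<beta> by (rule assms)
qed

lemma left_del_mono_zero [simp]: "left_del_mono \<beta> 0 = 0"
  by (induction \<beta> rule: mono_induct) (simp_all add: left_del_mono_unit')

lemma left_del_mono_add: "left_del_mono \<beta> (P + Q) = left_del_mono \<beta> P + left_del_mono \<beta> Q"
  by (induction \<beta> rule: mono_induct) (simp_all add: left_del_mono_unit' left_del_add)

lemma left_mult_zero_right [simp]: "left_mult P 0 = 0"
  by (simp add: left_mult_def)

lemma left_mult_zero_left [simp]: "left_mult 0 Q = 0"
  by (simp add: left_mult_def)

lemma left_mult_add_right: "left_mult P (Q + R) = left_mult P Q + left_mult P R"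
  by (simp add: left_mult_def left_del_mono_add distrib_left sum.distrib split_def)

lemma left_mult_single:
  "left_mult (Poly_Mapping.single (\<beta>, k) c) Q = Poly_Mapping.single (0, k) c * left_del_mono \<beta> Q"
  by (simp add: left_mult_def)

lemma left_mult_add_left: "left_mult (P + Q) R = left_mult P R + left_mult Q R"
  using setsum_keys_plus_distrib[where
      f = "\<lambda>s c. Poly_Mapping.single (0, snd s) c * left_del_mono (fst s) R" and p = P and q = Q]
  by (simp add: left_mult_def split_def single_add distrib_right)

lemma left_mult_scale:
  "left_mult (Poly_Mapping.single (0, k) c * P) Q = Poly_Mapping.single (0, k) c * left_mult P Q"
proof (induction P rule: poly_mapping_induct)
  case (single a b)
  show ?case
    by (cases a) (simp add: left_mult_single mult_single flip: mult.assoc)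
qed (simp_all add: left_mult_add_left distrib_left)

lemma left_mult_left_del: "left_mult (left_del i P) Q = left_del i (left_mult P Q)"
proof (induction P rule: poly_mapping_induct)
  case (single a c)
  obtain \<beta> k where a: "a = (\<beta>, k)"
    by (cases a)
  have "left_del i (Poly_Mapping.single (\<beta>, k) c) =
      Poly_Mapping.single (\<beta> + unit_mono i, k) c + Poly_Mapping.single (\<beta>, Suc k) (ratfun_deriv i c)"
    by (simp add: left_del_def coeff_deriv_single mult_single add.commute)
  then show ?case
    by (simp add: a left_mult_add_left left_mult_single left_del_mono_unit' left_del_scale)
qed (simp_all add: left_mult_add_left left_del_add)

lemma left_mult_left_del_mono:
  "left_mult (left_del_mono \<beta> P) Q = left_del_mono \<beta> (left_mult P Q)"
  by (induction \<beta> rule: mono_induct) (simp_all add: left_del_mono_unit' left_mult_left_del)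

lemma left_mult_assoc: "left_mult (left_mult P Q) R = left_mult P (left_mult Q R)"
proof (induction P rule: poly_mapping_induct)
  case (single a c)
  show ?case
    by (cases a) (simp add: left_mult_single left_mult_scale left_mult_left_del_mono)
qed (simp_all add: left_mult_add_left)

lemma left_mult_one_left: "left_mult 1 Q = Q"
  using left_mult_single[of 0 0 1 Q]
  by simp

lemma left_del_mono_one_right: "left_del_mono \<beta> 1 = Poly_Mapping.single (\<beta>, 0) 1"
proof (induction \<beta> rule: mono_induct)
  case zero
  show ?case
    by simp
next
  case (unit \<beta> i)
  then show ?case
    by (simp add: left_del_mono_unit' left_del_def coeff_deriv_single mult_single add.commute)
qed

lemma left_mult_one_right: "left_mult P 1 = P"
proof (induction P rule: poly_mapping_induct)
  case (single a c)
  show ?case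
    by (cases a) (simp add: left_mult_single left_del_mono_one_right mult_single)
qed (simp_all add: left_mult_add_left)

instantiation hdiff :: ("{finite,linorder}", field) ring_1
begin

lift_definition zero_hdiff :: "('a, 'b) hdiff" is 0 .
lift_definition one_hdiff :: "('a, 'b) hdiff" is 1 .
lift_definition plus_hdiff :: "('a, 'b) hdiff \<Rightarrow> ('a, 'b) hdiff \<Rightarrow> ('a, 'b) hdiff" is "(+)" .
lift_definition minus_hdiff :: "('a, 'b) hdiff \<Rightarrow> ('a, 'b) hdiff \<Rightarrow> ('a, 'b) hdiff" is "(-)" .
lift_definition uminus_hdiff :: "('a, 'b) hdiff \<Rightarrow> ('a, 'b) hdiff" is uminus .
lift_definition times_hdiff :: "('a, 'b) hdiff \<Rightarrow> ('a, 'b) hdiff \<Rightarrow> ('a, 'b) hdiff" is left_mult .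

instance
proof
  fix P Q R :: "('a, 'b) hdiff"
  show "P * Q * R = P * (Q * R)"
    by transfer (rule left_mult_assoc)
  show "1 * P = P"
    by transfer (rule left_mult_one_left)
  show "P * 1 = P"
    by transfer (rule left_mult_one_right)
  show "(P + Q) * R = P * R + Q * R"
    by transfer (rule left_mult_add_left)
  show "P * (Q + R) = P * Q + P * R"
    by transfer (rule left_mult_add_right)
  show "(0 :: ('a, 'b) hdiff) \<noteq> 1"
    by transfer simp
qed (transfer; simp add: algebra_simps)+

end

definition hconst :: "('n::{finite,linorder}, 'k::field) ratfun \<Rightarrow> ('n, 'k) hdiff" where
  "hconst c = Hdiff (Poly_Mapping.single (0, 0) c)"

definition hdel :: "'n \<Rightarrow> ('n::{finite,linorder}, 'k::field) hdiff" where
  "hdel i = Hdiff (Poly_Mapping.single (unit_mono i, 0) 1)"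

definition hh :: "('n::{finite,linorder}, 'k::field) hdiff" where
  "hh = Hdiff (Poly_Mapping.single (0, 1) 1)"

definition hD :: "('n::{finite,linorder}, 'k::field) hdiff set" where
  "hD = {P. \<forall>s. Poly_Mapping.lookup (coeffs P) s \<in> polynomials}"

definition hD0 :: "('n::{finite,linorder}, 'k::field) hdiff set" where
  "hD0 = {P. \<forall>s. Poly_Mapping.lookup (coeffs P) s \<in> local_ring}"

lemmas hgen_simps = hconst_def hdel_def hh_def plus_hdiff.abs_eq minus_hdiff.abs_eq times_hdiff.abs_eq
  left_mult_single mult_single left_del_mono_one left_del_mono_one[unfolded One_nat_def] left_del_def coeff_deriv_single

lemma hconst_add: "hconst (c + d) = hconst c + hconst d"
  by (simp add: hgen_simps single_add)

lemma hconst_mult: "hconst (c * d) = hconst c * hconst d"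
  by (simp add: hgen_simps)

lemma hconst_one: "hconst 1 = 1"
  by (simp add: hconst_def one_hdiff_def)

lemma hdel_commute: "hdel i * hdel j = hdel j * hdel i"
  by (simp add: hgen_simps add.commute)

lemma hh_hconst: "hh * hconst c = hconst c * hh"
  by (simp add: hgen_simps)

lemma hh_hdel: "hh * hdel i = hdel i * hh"
  by (simp add: hgen_simps)

lemma hdel_hconst: "hdel i * hconst c - hconst c * hdel i = hconst (ratfun_deriv i c) * hh"
  by (simp add: hgen_simps)

definition subring :: "'a::ring_1 set \<Rightarrow> bool" where
  "subring R \<longleftrightarrow> 0 \<in> R \<and> 1 \<in> R \<and> (\<forall>a\<in>R. - a \<in> R) \<and> (\<forall>a\<in>R. \<forall>b\<in>R. a + b \<in> R \<and> a * b \<in> R)"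

lemma subring_sum: "subring R \<Longrightarrow> (\<And>a. a \<in> A \<Longrightarrow> f a \<in> R) \<Longrightarrow> sum f A \<in> R"
  by (induction A rule: infinite_finite_induct) (auto simp: subring_def)

lemma subring_polynomials: "subring polynomials"
  unfolding subring_def
proof (intro conjI ballI)
  show "0 \<in> polynomials" "1 \<in> polynomials"
    by (auto simp: polynomials_def Zero_fract_def One_fract_def)
  fix a b :: "('a, 'b) ratfun"
  assume "a \<in> polynomials"
  then obtain f where f: "a = Fract f 1"
    by (auto simp: polynomials_def)
  show "- a \<in> polynomials"
    by (auto simp: polynomials_def f)
  assume "b \<in> polynomials"
  then obtain g where g: "b = Fract g 1"
    by (auto simp: polynomials_def)
  show "a + b \<in> polynomials" "a * b \<in> polynomials"
    by (auto simp: polynomials_def f g)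
qed

lemma deriv_polynomials: "a \<in> polynomials \<Longrightarrow> ratfun_deriv i a \<in> polynomials"
  by (auto simp: polynomials_def ratfun_deriv_Fract)

lemma lookup_mult_0:
  fixes f g :: "('n, 'k::comm_ring_1) mpoly"
  shows "Poly_Mapping.lookup (f * g) 0 = Poly_Mapping.lookup f 0 * Poly_Mapping.lookup g 0"
proof (induction f rule: poly_mapping_induct)
  case (single \<alpha> a)
  have *: "\<alpha> + \<beta> = 0 \<longleftrightarrow> \<alpha> = 0 \<and> \<beta> = 0" for \<beta> :: "'n mono"
    by (auto simp: poly_mapping_eq_iff fun_eq_iff lookup_add)
  show ?case
    by (induction g rule: poly_mapping_induct)
       (auto simp: mult_single lookup_single when_def * lookup_add distrib_left)
qed (simp_all add: lookup_add distrib_right)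

lemma local_ringE:
  assumes "a \<in> local_ring"
  obtains f g where "a = Fract f g" "Poly_Mapping.lookup g 0 \<noteq> 0" "g \<noteq> 0"
proof -
  from assms obtain f g where fg: "a = Fract f g" "Poly_Mapping.lookup g 0 \<noteq> 0"
    unfolding local_ring_def by blast
  from fg(2) have "g \<noteq> 0"
    by (metis lookup_zero)
  with fg show ?thesis
    by (rule that)
qed

lemma local_ringI: "Poly_Mapping.lookup g 0 \<noteq> 0 \<Longrightarrow> Fract f g \<in> local_ring"
  by (auto simp: local_ring_def)

lemma subring_local_ring: "subring local_ring"
  unfolding subring_def
proof (intro conjI ballI)
  show "0 \<in> local_ring" "1 \<in> local_ring"
    by (auto simp: Zero_fract_def One_fract_def intro!: local_ringI)
  fix a b :: "('a, 'b) ratfun"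
  assume "a \<in> local_ring"
  then obtain f g where f: "a = Fract f g" "Poly_Mapping.lookup g 0 \<noteq> 0" "g \<noteq> 0"
    by (rule local_ringE)
  show "- a \<in> local_ring"
    using f by (auto intro!: local_ringI)
  assume "b \<in> local_ring"
  then obtain f' g' where g: "b = Fract f' g'" "Poly_Mapping.lookup g' 0 \<noteq> 0" "g' \<noteq> 0"
    by (rule local_ringE)
  show "a + b \<in> local_ring" "a * b \<in> local_ring"
    using f g by (auto intro!: local_ringI simp: lookup_mult_0)
qed

lemma deriv_local_ring: "a \<in> local_ring \<Longrightarrow> ratfun_deriv i a \<in> local_ring"
  by (erule local_ringE) (auto simp: ratfun_deriv_Fract lookup_mult_0 intro!: local_ringI)

lemma lookup_mult_subring:
  fixes P Q :: "'a::monoid_add \<Rightarrow>\<^sub>0 'b::comm_ring_1"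
  assumes R: "subring R" and "\<And>s. Poly_Mapping.lookup P s \<in> R" "\<And>s. Poly_Mapping.lookup Q s \<in> R"
  shows "Poly_Mapping.lookup (P * Q) s \<in> R"
proof -
  have "P * Q = (\<Sum>a\<in>Poly_Mapping.keys P. Poly_Mapping.single a (Poly_Mapping.lookup P a)) *
      (\<Sum>b\<in>Poly_Mapping.keys Q. Poly_Mapping.single b (Poly_Mapping.lookup Q b))"
    by (simp flip: poly_mapping_sum_singles)
  also have "\<dots> = (\<Sum>a\<in>Poly_Mapping.keys P. \<Sum>b\<in>Poly_Mapping.keys Q.
      Poly_Mapping.single (a + b) (Poly_Mapping.lookup P a * Poly_Mapping.lookup Q b))"
    by (simp add: sum_product mult_single)
  finally show ?thesis
    using R assms(2,3)
    by (auto simp: lookup_sum lookup_single when_def subring_def intro!: subring_sum[OF R])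
qed

lemma lookup_left_del_mono_subring:
  fixes R :: "('n::{finite,linorder}, 'k::field) ratfun set"
  assumes R: "subring R" and D: "\<And>a i. a \<in> R \<Longrightarrow> ratfun_deriv i a \<in> R"
    and Q: "\<And>s. Poly_Mapping.lookup Q s \<in> R"
  shows "Poly_Mapping.lookup (left_del_mono \<beta> Q) s \<in> R"
proof (induction \<beta> arbitrary: s rule: mono_induct)
  case zero
  show ?case
    using Q by simp
next
  case (unit \<beta> i)
  have 01: "0 \<in> R" "1 \<in> R"
    using R by (auto simp: subring_def)
  have "Poly_Mapping.lookup (Poly_Mapping.single (unit_mono i, 0) 1 * left_del_mono \<beta> Q) s \<in> R"
    "Poly_Mapping.lookup (Poly_Mapping.single (0, 1) 1 * coeff_deriv i (left_del_mono \<beta> Q)) s \<in> R"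
    by (intro lookup_mult_subring[OF R]; auto simp: lookup_single when_def coeff_deriv_lookup unit D 01)+
  then show ?case
    using R unfolding left_del_mono_unit left_del_def lookup_add by (auto simp: subring_def)
qed

lemma subring_coeffs:
  fixes R :: "('n::{finite,linorder}, 'k::field) ratfun set"
  assumes R: "subring R" and D: "\<And>a i. a \<in> R \<Longrightarrow> ratfun_deriv i a \<in> R"
  shows "subring {P. \<forall>s. Poly_Mapping.lookup (coeffs P) s \<in> R}"
  unfolding subring_def
proof (intro conjI ballI)
  have R': "0 \<in> R" "1 \<in> R" "\<And>a. a \<in> R \<Longrightarrow> - a \<in> R" "\<And>a b. a \<in> R \<Longrightarrow> b \<in> R \<Longrightarrow> a + b \<in> R"
    using R by (auto simp: subring_def)
  show "0 \<in> {P. \<forall>s. Poly_Mapping.lookup (coeffs P) s \<in> R}"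
    "1 \<in> {P. \<forall>s. Poly_Mapping.lookup (coeffs P) s \<in> R}"
    using R' by (auto simp: zero_hdiff.rep_eq one_hdiff.rep_eq lookup_one when_def)
  fix P Q :: "('n, 'k) hdiff"
  assume P: "P \<in> {P. \<forall>s. Poly_Mapping.lookup (coeffs P) s \<in> R}"
  show "- P \<in> {P. \<forall>s. Poly_Mapping.lookup (coeffs P) s \<in> R}"
    using P R' by (auto simp: uminus_hdiff.rep_eq)
  assume Q: "Q \<in> {P. \<forall>s. Poly_Mapping.lookup (coeffs P) s \<in> R}"
  show "P + Q \<in> {P. \<forall>s. Poly_Mapping.lookup (coeffs P) s \<in> R}"
    using P Q R' by (auto simp: plus_hdiff.rep_eq lookup_add)
  have "Poly_Mapping.lookup (Poly_Mapping.single (0, k) (Poly_Mapping.lookup (coeffs P) (\<beta>, k)) *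
      left_del_mono \<beta> (coeffs Q)) s \<in> R" for \<beta> k s
    using P Q R' by (intro lookup_mult_subring[OF R] lookup_left_del_mono_subring[OF R D])
      (auto simp: lookup_single when_def)
  then show "P * Q \<in> {P. \<forall>s. Poly_Mapping.lookup (coeffs P) s \<in> R}"
    by (auto simp: times_hdiff.rep_eq left_mult_def lookup_sum intro!: subring_sum[OF R])
qed

lemma left_mult_sum_left: "left_mult (sum f A) Q = (\<Sum>a\<in>A. left_mult (f a) Q)"
  by (induction A rule: infinite_finite_induct) (auto simp: left_mult_add_left)

lemma Hdiff_sum: "Hdiff (sum f A) = (\<Sum>a\<in>A. Hdiff (f a))"
  by (induction A rule: infinite_finite_induct) (auto simp: zero_hdiff_def plus_hdiff.abs_eq[symmetric])

lemma Hdiff_single: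
  "Hdiff (Poly_Mapping.single (\<beta>, k) c) = hconst c * (hh ^ k * Hdiff (Poly_Mapping.single (\<beta>, 0) 1))"
proof (induction k)
  case 0
  show ?case
    by (simp add: hconst_def times_hdiff.abs_eq left_mult_single mult_single)
next
  case (Suc k)
  have "Hdiff (Poly_Mapping.single (\<beta>, Suc k) c) = hh * Hdiff (Poly_Mapping.single (\<beta>, k) c)"
    by (simp add: hh_def times_hdiff.abs_eq left_mult_single mult_single)
  also have "\<dots> = hconst c * (hh * (hh ^ k * Hdiff (Poly_Mapping.single (\<beta>, 0) 1)))"
    unfolding Suc by (simp add: hh_hconst flip: mult.assoc)
  finally show ?case
    by (simp add: mult.assoc)
qed

lemma Hdiff_single_unit:
  "Hdiff (Poly_Mapping.single (\<beta> + unit_mono i, 0) 1) = hdel i * Hdiff (Poly_Mapping.single (\<beta>, 0) 1)"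
  unfolding hdel_def times_hdiff.abs_eq left_mult_single left_del_mono_one left_del_def
  by (simp add: coeff_deriv_single mult_single add.commute)

lemma subring_hull_coeffs:
  fixes R :: "('n::{finite,linorder}, 'k::field) ratfun set"
  assumes R: "subring R" and D: "\<And>a i. a \<in> R \<Longrightarrow> ratfun_deriv i a \<in> R"
  shows "{P. \<forall>s. Poly_Mapping.lookup (coeffs P) s \<in> R} = subring hull (hconst ` R \<union> range hdel \<union> {hh})"
    (is "?A = _")
proof (rule hull_unique[symmetric])
  show "subring ?A"
    using R D by (rule subring_coeffs)
  have 01: "0 \<in> R" "1 \<in> R"
    using R by (auto simp: subring_def)
  show "hconst ` R \<union> range hdel \<union> {hh} \<subseteq> ?A"
    using 01 by (auto simp: hconst_def hdel_def hh_def Hdiff_inverse lookup_single when_def)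
next
  fix S :: "('n, 'k) hdiff set"
  assume gens: "hconst ` R \<union> range hdel \<union> {hh} \<subseteq> S" and S: "subring S"
  have mult: "a * b \<in> S" if "a \<in> S" "b \<in> S" for a b
    using S that by (auto simp: subring_def)
  have const: "hconst c \<in> S" if "c \<in> R" for c
    by (rule subsetD[OF gens]) (rule UnI1, rule UnI1, rule imageI, rule that)
  have h: "hh ^ k \<in> S" for k
    using gens S by (induction k) (auto simp: subring_def)
  have one: "Hdiff (Poly_Mapping.single (0, 0) 1) \<in> S"
    using S by (simp add: subring_def one_hdiff_def)
  have del: "Hdiff (Poly_Mapping.single (\<beta>, 0) 1) \<in> S" for \<beta>
  proof (induction \<beta> rule: mono_induct)
    case zero
    show ?case
      by (rule one)
  next
    case (unit \<beta> i)
    show ?case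
      unfolding Hdiff_single_unit by (rule mult[OF _ unit]) (use gens in auto)
  qed
  show "?A \<subseteq> S"
  proof
    fix P
    assume P: "P \<in> ?A"
    have "P = Hdiff (coeffs P)"
      by (rule coeffs_inverse[symmetric])
    also have "\<dots> = Hdiff (\<Sum>s\<in>Poly_Mapping.keys (coeffs P).
        Poly_Mapping.single s (Poly_Mapping.lookup (coeffs P) s))"
      by (rule arg_cong[OF poly_mapping_sum_singles])
    also have "\<dots> = (\<Sum>s\<in>Poly_Mapping.keys (coeffs P).
        Hdiff (Poly_Mapping.single s (Poly_Mapping.lookup (coeffs P) s)))"
      by (rule Hdiff_sum)
    finally have eq: "P = (\<Sum>s\<in>Poly_Mapping.keys (coeffs P).
        Hdiff (Poly_Mapping.single s (Poly_Mapping.lookup (coeffs P) s)))" .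
    have mem: "Hdiff (Poly_Mapping.single s (Poly_Mapping.lookup (coeffs P) s)) \<in> S" for s
    proof (cases s)
      case (Pair \<beta> k)
      have "Poly_Mapping.lookup (coeffs P) (\<beta>, k) \<in> R"
        using P by simp
      then show ?thesis
        unfolding Pair by (subst Hdiff_single) (intro mult const h del)
    qed
    have "(\<Sum>s\<in>Poly_Mapping.keys (coeffs P).
        Hdiff (Poly_Mapping.single s (Poly_Mapping.lookup (coeffs P) s))) \<in> S"
      by (rule subring_sum[OF S mem])
    then show "P \<in> S"
      by (rule subst[OF eq[symmetric], where P = "\<lambda>x. x \<in> S"])
  qed
qed

lemma hD_eq_hull: "hD = subring hull (hconst ` polynomials \<union> range hdel \<union> {hh})"
  unfolding hD_def by (rule subring_hull_coeffs[OF subring_polynomials deriv_polynomials])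

lemma hD0_eq_hull: "hD0 = subring hull (hconst ` local_ring \<union> range hdel \<union> {hh})"
  unfolding hD0_def by (rule subring_hull_coeffs[OF subring_local_ring deriv_local_ring])


section \<open>Supports, initial ideals and the induced partition of weights\<close>

definition ps_mult ::
  "('n::finite mono \<Rightarrow> 'k::comm_ring_1) \<Rightarrow> ('n mono \<Rightarrow> 'k) \<Rightarrow> 'n mono \<Rightarrow> 'k" where
  "ps_mult a b \<gamma> = (\<Sum>(\<mu>, \<nu>) | \<mu> + \<nu> = \<gamma>. a \<mu> * b \<nu>)"

text \<open>
  The coefficients of the power series expansion at \<open>0\<close> of an element \<open>f/g\<close> of the local ring,
  i.e. of the power series \<open>a\<close> with \<open>g a = f\<close>.
\<close>

definition taylor_coeffs :: "('n::{finite,linorder}, 'k::field) ratfun \<Rightarrow> 'n mono \<Rightarrow> 'k" where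
  "taylor_coeffs r = (THE a. \<exists>f g. r = Fract f g \<and> Poly_Mapping.lookup g 0 \<noteq> 0 \<and>
     ps_mult (Poly_Mapping.lookup g) a = Poly_Mapping.lookup f)"

type_synonym 'n expo = "'n mono \<times> 'n mono \<times> nat"

fun hcoeff :: "('n::{finite,linorder}, 'k::field) hdiff \<Rightarrow> 'n expo \<Rightarrow> 'k" where
  "hcoeff P (\<alpha>, \<beta>, k) = taylor_coeffs (Poly_Mapping.lookup (coeffs P) (\<beta>, k)) \<alpha>"

definition Supp :: "('n::{finite,linorder}, 'k::field) hdiff \<Rightarrow> 'n expo set" where
  "Supp P = {s. hcoeff P s \<noteq> 0}"

definition homogeneous :: "('n::{finite,linorder}, 'k::field) hdiff \<Rightarrow> bool" where
  "homogeneous P \<longleftrightarrow> (\<exists>d. \<forall>(\<alpha>, \<beta>, k)\<in>Supp P. mono_degree \<beta> + k = d)"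

definition left_ideal :: "'a::ring_1 set \<Rightarrow> 'a set \<Rightarrow> bool" where
  "left_ideal A I \<longleftrightarrow> I \<subseteq> A \<and> 0 \<in> I \<and> (\<forall>a\<in>I. \<forall>b\<in>I. a + b \<in> I) \<and> (\<forall>r\<in>A. \<forall>a\<in>I. r * a \<in> I)"

definition homogeneous_ideal ::
  "('n::{finite,linorder}, 'k::field) hdiff set \<Rightarrow> ('n, 'k) hdiff set \<Rightarrow> bool" where
  "homogeneous_ideal A I \<longleftrightarrow> (\<exists>G\<subseteq>A. (\<forall>P\<in>G. homogeneous P) \<and> I = left_ideal A hull G)"

type_synonym 'n weight_vector = "(real ^ 'n) \<times> (real ^ 'n)"

definition W_loc :: "'n::finite weight_vector set" where
  "W_loc = {(u, v). \<forall>i. u $ i < 0 \<and> u $ i + v $ i > 0}"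

fun weight :: "'n weight_vector \<Rightarrow> 'n::finite expo \<Rightarrow> real" where
  "weight (u, v) (\<alpha>, \<beta>, k) =
     (\<Sum>i\<in>UNIV. u $ i * real (Poly_Mapping.lookup \<alpha> i)) +
     (\<Sum>i\<in>UNIV. v $ i * real (Poly_Mapping.lookup \<beta> i))"

text \<open>
  The support may be infinite, but for weights in \<open>W_loc\<close> the maximum exists and is attained
  only finitely often (\<open>ord_w_attained\<close> and \<open>finite_Supp_ge\<close> below).
\<close>

definition ord_w ::
  "'n weight_vector \<Rightarrow> ('n::{finite,linorder}, 'k::field) hdiff \<Rightarrow> real" where
  "ord_w w P = (GREATEST m. m \<in> weight w ` Supp P)"

text \<open>
  For \<open>w\<close> in \<open>W_loc\<close> the graded ring is identified with the commutative ring \<open>k[x, \<xi>, h]\<close>, whose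
  monomials \<open>x\<^sup>\<alpha> \<xi>\<^sup>\<beta> h\<^sup>k\<close> are indexed by \<open>(\<alpha>, \<beta>, k)\<close>.  The class of \<open>P\<close> modulo operators of smaller
  order is then the sum of the terms of \<open>P\<close> of maximal weight, with \<open>\<partial>\<^sub>i\<close> replaced by \<open>\<xi>\<^sub>i\<close>.
\<close>

definition in_w ::
  "'n weight_vector \<Rightarrow> ('n::{finite,linorder}, 'k::field) hdiff \<Rightarrow> 'n expo \<Rightarrow>\<^sub>0 'k" where
  "in_w w P = (\<Sum>s | s \<in> Supp P \<and> weight w s = ord_w w P. Poly_Mapping.single s (hcoeff P s))"

definition initial_ideal ::
  "'n weight_vector \<Rightarrow> ('n::{finite,linorder}, 'k::field) hdiff set \<Rightarrow> ('n expo \<Rightarrow>\<^sub>0 'k) set" where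
  "initial_ideal w I = left_ideal UNIV hull (in_w w ` I)"

text \<open>
  Meant for subsets \<open>W\<close> of \<open>W_loc\<close>, where all weights have the same graded ring and comparing the
  initial ideals suffices.
\<close>

definition weight_classes ::
  "('n::{finite,linorder}, 'k::field) hdiff set \<Rightarrow> 'n weight_vector set \<Rightarrow>
     'n weight_vector set set" where
  "weight_classes I W =
     W // {(w, w'). w \<in> W \<and> w' \<in> W \<and> initial_ideal w I = initial_ideal w' I}"


subsection \<open>Well-definedness\<close>

lemma finite_mono_splits: "finite {(\<mu>, \<nu>). \<mu> + \<nu> = (\<gamma> :: 'n::finite mono)}"
proof -
  have fin: "finite {\<mu>. \<forall>i. Poly_Mapping.lookup \<mu> i \<le> Poly_Mapping.lookup \<gamma> i}" (is "finite ?S")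
  proof (rule finite_imageD)
    have "Poly_Mapping.lookup ` ?S \<subseteq> Pi\<^sub>E UNIV (\<lambda>i. {..Poly_Mapping.lookup \<gamma> i})"
      by auto
    then show "finite (Poly_Mapping.lookup ` ?S)"
      by (rule finite_subset) (simp add: finite_PiE)
    show "inj_on Poly_Mapping.lookup ?S"
      by (simp add: inj_on_def)
  qed
  have "{(\<mu>, \<nu>). \<mu> + \<nu> = \<gamma>} \<subseteq> ?S \<times> ?S"
    by (auto simp: lookup_add)
  then show ?thesis
    using fin by (meson finite_SigmaI finite_subset)
qed

lemma ps_mult_commute: "ps_mult a b = ps_mult b a"
  unfolding ps_mult_def
  by (intro ext sum.reindex_bij_witness[of _ prod.swap prod.swap]) (auto simp: add.commute mult.commute)

lemma ps_mult_assoc: "ps_mult (ps_mult a b) c = ps_mult a (ps_mult b c)"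
proof
  fix \<gamma>
  have "ps_mult (ps_mult a b) c \<gamma> =
      (\<Sum>x | fst x + snd x = \<gamma>. \<Sum>y | fst y + snd y = fst x. a (fst y) * b (snd y) * c (snd x))"
    by (simp add: ps_mult_def split_def sum_distrib_right)
  also have "\<dots> = (\<Sum>(x, y)\<in>(SIGMA x:{x. fst x + snd x = \<gamma>}. {y. fst y + snd y = fst x}).
      a (fst y) * b (snd y) * c (snd x))"
    using finite_mono_splits by (subst sum.Sigma) (auto simp: split_def)
  also have "\<dots> = (\<Sum>(x, y)\<in>(SIGMA x:{x. fst x + snd x = \<gamma>}. {y. fst y + snd y = snd x}).
      a (fst x) * (b (fst y) * c (snd y)))"
    by (rule sum.reindex_bij_witness[of _
          "\<lambda>(x, y). ((fst x + fst y, snd y), (fst x, fst y))"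
          "\<lambda>(x, y). ((fst y, snd y + snd x), (snd y, snd x))"])
       (auto simp: algebra_simps)
  also have "\<dots> = (\<Sum>x | fst x + snd x = \<gamma>. \<Sum>y | fst y + snd y = snd x.
      a (fst x) * (b (fst y) * c (snd y)))"
    using finite_mono_splits by (subst sum.Sigma) (auto simp: split_def)
  also have "\<dots> = ps_mult a (ps_mult b c) \<gamma>"
    by (simp add: ps_mult_def split_def sum_distrib_left)
  finally show "ps_mult (ps_mult a b) c \<gamma> = ps_mult a (ps_mult b c) \<gamma>" .
qed

lemma lookup_mult_ps: "Poly_Mapping.lookup (p * q) = ps_mult (Poly_Mapping.lookup p) (Poly_Mapping.lookup q)"
proof
  fix \<gamma>
  show "Poly_Mapping.lookup (p * q) \<gamma> = ps_mult (Poly_Mapping.lookup p) (Poly_Mapping.lookup q) \<gamma>"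
  proof (induction p rule: poly_mapping_induct)
    case (single \<alpha> a)
    show ?case
    proof (induction q rule: poly_mapping_induct)
      case (single \<beta> b)
      have "ps_mult (Poly_Mapping.lookup (Poly_Mapping.single \<alpha> a))
          (Poly_Mapping.lookup (Poly_Mapping.single \<beta> b)) \<gamma> =
        (\<Sum>x | fst x + snd x = \<gamma>. if x = (\<alpha>, \<beta>) then a * b else 0)"
        unfolding ps_mult_def split_def by (rule sum.cong) (auto simp: lookup_single when_def)
      also have "\<dots> = (if \<alpha> + \<beta> = \<gamma> then a * b else 0)"
        using finite_mono_splits[of \<gamma>] by (simp add: sum.delta split_def)
      finally show ?case
        unfolding mult_single lookup_single when_def by (rule sym)
    qed (simp_all add: ps_mult_def lookup_add distrib_left sum.distrib split_def)
  qed (simp_all add: ps_mult_def lookup_add distrib_right sum.distrib split_def)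
qed

lemma ps_mult_split_0:
  "ps_mult g a \<gamma> = g 0 * a \<gamma> + (\<Sum>(\<mu>, \<nu>) | \<mu> + \<nu> = \<gamma> \<and> \<nu> \<noteq> \<gamma>. g \<mu> * a \<nu>)"
proof -
  have "{(\<mu>, \<nu>). \<mu> + \<nu> = \<gamma>} = insert (0, \<gamma>) {(\<mu>, \<nu>). \<mu> + \<nu> = \<gamma> \<and> \<nu> \<noteq> \<gamma>}"
    by auto
  moreover have "finite {(\<mu>, \<nu>). \<mu> + \<nu> = \<gamma> \<and> \<nu> \<noteq> \<gamma>}"
    by (rule finite_subset[OF _ finite_mono_splits[of \<gamma>]]) auto
  ultimately show ?thesis
    by (simp add: ps_mult_def)
qed

lemma mono_degree_less:
  assumes "\<mu> + \<nu> = \<gamma>" "\<nu> \<noteq> \<gamma>"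
  shows "mono_degree \<nu> < mono_degree \<gamma>"
proof -
  have "\<mu> \<noteq> 0"
    using assms by auto
  then obtain i where "Poly_Mapping.lookup \<mu> i \<noteq> 0"
    by (metis lookup_zero poly_mapping_eqI)
  then have "mono_degree \<mu> \<noteq> 0"
    by (auto simp: mono_degree_def)
  moreover have "mono_degree \<gamma> = mono_degree \<mu> + mono_degree \<nu>"
    by (simp add: mono_degree_def lookup_add sum.distrib flip: assms(1))
  ultimately show ?thesis
    by simp
qed

lemma ps_mult_cancel:
  fixes g :: "'n::finite mono \<Rightarrow> 'k::field"
  assumes "g 0 \<noteq> 0" "ps_mult g a = ps_mult g b"
  shows "a = b"
proof
  fix \<gamma>
  show "a \<gamma> = b \<gamma>"
  proof (induction "mono_degree \<gamma>" arbitrary: \<gamma> rule: less_induct)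
    case less
    have "(\<Sum>(\<mu>, \<nu>) | \<mu> + \<nu> = \<gamma> \<and> \<nu> \<noteq> \<gamma>. g \<mu> * a \<nu>) = (\<Sum>(\<mu>, \<nu>) | \<mu> + \<nu> = \<gamma> \<and> \<nu> \<noteq> \<gamma>. g \<mu> * b \<nu>)"
      by (rule sum.cong) (auto intro!: less mono_degree_less)
    moreover have "ps_mult g a \<gamma> = ps_mult g b \<gamma>"
      using assms by simp
    ultimately show ?case
      using assms(1) by (simp add: ps_mult_split_0)
  qed
qed

function ps_divide :: "('n::finite mono \<Rightarrow> 'k::field) \<Rightarrow> ('n mono \<Rightarrow> 'k) \<Rightarrow> 'n mono \<Rightarrow> 'k" where
  "ps_divide f g \<gamma> =
     (f \<gamma> - (\<Sum>x | fst x + snd x = \<gamma> \<and> snd x \<noteq> \<gamma>. g (fst x) * ps_divide f g (snd x))) / g 0"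
  by auto
termination
  by (relation "measure (\<lambda>(f, g, \<gamma>). mono_degree \<gamma>)") (auto intro: mono_degree_less)

declare ps_divide.simps [simp del]

lemma ps_mult_divide: "g 0 \<noteq> 0 \<Longrightarrow> ps_mult g (ps_divide f g) = f"
  by (rule ext, subst ps_mult_split_0, subst ps_divide.simps) (simp add: split_def)

lemma taylor_coeffs_Fract:
  fixes f g :: "('n::{finite,linorder}, 'k::field) mpoly"
  assumes g: "Poly_Mapping.lookup g 0 \<noteq> 0"
  shows "ps_mult (Poly_Mapping.lookup g) a = Poly_Mapping.lookup f \<longleftrightarrow> taylor_coeffs (Fract f g) = a"
proof -
  define a0 where "a0 = ps_divide (Poly_Mapping.lookup f) (Poly_Mapping.lookup g)"
  have a0: "ps_mult (Poly_Mapping.lookup g) a0 = Poly_Mapping.lookup f"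
    unfolding a0_def using g by (rule ps_mult_divide)
  have "taylor_coeffs (Fract f g) = a0"
    unfolding taylor_coeffs_def
  proof (rule the_equality)
    show "\<exists>f' g'. Fract f g = Fract f' g' \<and> Poly_Mapping.lookup g' 0 \<noteq> 0 \<and>
        ps_mult (Poly_Mapping.lookup g') a0 = Poly_Mapping.lookup f'"
      using g a0 by blast
  next
    fix b
    assume "\<exists>f' g'. Fract f g = Fract f' g' \<and> Poly_Mapping.lookup g' 0 \<noteq> 0 \<and>
        ps_mult (Poly_Mapping.lookup g') b = Poly_Mapping.lookup f'"
    then obtain f' g' where eq: "Fract f g = Fract f' g'" and g': "Poly_Mapping.lookup g' 0 \<noteq> 0"
      and b: "ps_mult (Poly_Mapping.lookup g') b = Poly_Mapping.lookup f'"
      by blast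
    have "g \<noteq> 0" "g' \<noteq> 0"
      using g g' by auto
    then have "f * g' = f' * g"
      using eq by (simp add: eq_fract)
    then have eq': "ps_mult (Poly_Mapping.lookup f) (Poly_Mapping.lookup g') =
        ps_mult (Poly_Mapping.lookup f') (Poly_Mapping.lookup g)"
      by (simp flip: lookup_mult_ps)
    have "ps_mult (Poly_Mapping.lookup g') (ps_mult (Poly_Mapping.lookup g) b) =
        ps_mult (Poly_Mapping.lookup g) (Poly_Mapping.lookup f')"
      by (metis b ps_mult_assoc ps_mult_commute)
    also have "\<dots> = ps_mult (Poly_Mapping.lookup g') (ps_mult (Poly_Mapping.lookup g) a0)"
      using eq' by (metis a0 ps_mult_commute)
    finally have "ps_mult (Poly_Mapping.lookup g) b = ps_mult (Poly_Mapping.lookup g) a0"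
      using g' by (rule ps_mult_cancel[rotated])
    then show "b = a0"
      using g by (rule ps_mult_cancel[rotated])
  qed
  then show ?thesis
    using a0 ps_mult_cancel[of "Poly_Mapping.lookup g" a a0] g by auto
qed

lemma taylor_coeffs_polynomial: "taylor_coeffs (Fract f 1) = Poly_Mapping.lookup f"
  by (subst taylor_coeffs_Fract[symmetric]) (simp_all flip: lookup_mult_ps)

lemma taylor_coeffs_zero [simp]: "taylor_coeffs 0 \<alpha> = 0"
  by (subst Zero_fract_def, subst taylor_coeffs_polynomial) (rule lookup_zero)

lemma finite_Supp_ge:
  fixes w :: "'n::{finite,linorder} weight_vector" and P :: "('n, 'k::field) hdiff"
  assumes "w \<in> W_loc"
  shows "finite {s \<in> Supp P. m \<le> weight w s}"
proof -
  obtain u v where w: "w = (u, v)" and u: "\<And>i. u $ i < 0"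
    using assms by (auto simp: W_loc_def)
  define V where "V \<beta> = (\<Sum>i\<in>UNIV. v $ i * real (Poly_Mapping.lookup \<beta> i))" for \<beta> :: "'n mono"
  define B where "B \<beta> i = nat \<lfloor>(V \<beta> - m) / - u $ i\<rfloor>" for \<beta> i
  define S where "S \<beta> = {\<alpha>. \<forall>i. Poly_Mapping.lookup \<alpha> i \<le> B \<beta> i}" for \<beta>
  have fin: "finite (S \<beta>)" for \<beta>
  proof (rule finite_imageD)
    have "Poly_Mapping.lookup ` S \<beta> \<subseteq> Pi\<^sub>E UNIV (\<lambda>i. {..B \<beta> i})"
      by (auto simp: S_def)
    then show "finite (Poly_Mapping.lookup ` S \<beta>)"
      by (rule finite_subset) (simp add: finite_PiE)
    show "inj_on Poly_Mapping.lookup (S \<beta>)"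
      by (simp add: inj_on_def)
  qed
  have "{s \<in> Supp P. m \<le> weight w s} \<subseteq>
      (\<Union>(\<beta>, k)\<in>Poly_Mapping.keys (coeffs P). (\<lambda>\<alpha>. (\<alpha>, \<beta>, k)) ` S \<beta>)"
  proof
    fix s
    assume s: "s \<in> {s \<in> Supp P. m \<le> weight w s}"
    obtain \<alpha> \<beta> k where [simp]: "s = (\<alpha>, \<beta>, k)"
      by (cases s)
    have "Poly_Mapping.lookup (coeffs P) (\<beta>, k) \<noteq> 0"
      using s by (auto simp: Supp_def)
    then have key: "(\<beta>, k) \<in> Poly_Mapping.keys (coeffs P)"
      by (simp add: in_keys_iff)
    have "Poly_Mapping.lookup \<alpha> i \<le> B \<beta> i" for i
    proof -
      have "m - V \<beta> \<le> (\<Sum>j\<in>UNIV. u $ j * real (Poly_Mapping.lookup \<alpha> j))"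
        using s by (simp add: w V_def)
      also have "\<dots> \<le> u $ i * real (Poly_Mapping.lookup \<alpha> i)"
      proof -
        have "(\<Sum>j\<in>UNIV - {i}. u $ j * real (Poly_Mapping.lookup \<alpha> j)) \<le> 0"
          using u by (intro sum_nonpos mult_nonpos_nonneg) (auto intro: less_imp_le)
        then show ?thesis
          by (simp add: sum.remove[of UNIV i])
      qed
      finally have "real (Poly_Mapping.lookup \<alpha> i) \<le> (V \<beta> - m) / - u $ i"
        using u[of i] by (simp add: field_simps)
      then show ?thesis
        unfolding B_def by (simp add: le_nat_floor)
    qed
    then show "s \<in> (\<Union>(\<beta>, k)\<in>Poly_Mapping.keys (coeffs P). (\<lambda>\<alpha>. (\<alpha>, \<beta>, k)) ` S \<beta>)"
      using key by (force simp: S_def)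
  qed
  moreover have "finite (\<Union>(\<beta>, k)\<in>Poly_Mapping.keys (coeffs P). (\<lambda>\<alpha>. (\<alpha>, \<beta>, k)) ` S \<beta>)"
    using fin by auto
  ultimately show ?thesis
    by (rule finite_subset)
qed

lemma ord_w_attained:
  fixes w :: "'n::{finite,linorder} weight_vector" and P :: "('n, 'k::field) hdiff"
  assumes "w \<in> W_loc" "Supp P \<noteq> {}"
  shows "ord_w w P \<in> weight w ` Supp P" and "\<And>s. s \<in> Supp P \<Longrightarrow> weight w s \<le> ord_w w P"
proof -
  obtain s0 where s0: "s0 \<in> Supp P"
    using assms by auto
  define M where "M = Max (weight w ` {s \<in> Supp P. weight w s0 \<le> weight w s})"
  have fin: "finite (weight w ` {s \<in> Supp P. weight w s0 \<le> weight w s})"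
    using finite_Supp_ge[OF assms(1)] by (rule finite_imageI)
  have "M \<in> weight w ` {s \<in> Supp P. weight w s0 \<le> weight w s}"
    unfolding M_def using s0 by (intro Max_in fin) blast
  then have M: "M \<in> weight w ` Supp P"
    by auto
  have le: "weight w s \<le> M" if "s \<in> Supp P" for s
  proof (cases "weight w s0 \<le> weight w s")
    case True
    then show ?thesis
      unfolding M_def using that by (intro Max_ge fin) auto
  next
    case False
    moreover have "weight w s0 \<le> M"
      unfolding M_def using s0 by (intro Max_ge fin) auto
    ultimately show ?thesis
      by simp
  qed
  have "ord_w w P = M"
    unfolding ord_w_def by (rule Greatest_equality) (use M le in auto)
  then show "ord_w w P \<in> weight w ` Supp P" and "\<And>s. s \<in> Supp P \<Longrightarrow> weight w s \<le> ord_w w P"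
    using M le by auto
qed

end

theory Submission
  imports Defs
begin

text \<open>
  Both partitions coincide because already the initial ideals do: for every weight \<open>w = (u, v)\<close> in
  \<open>W_loc\<close>, \<open>I\<close> and its extension \<open>hD0 I\<close> have the same initial ideal.

  The elements of \<open>hD0\<close> carry their denominators in their coefficients, that is, on the left, and
  an operator has only finitely many coefficients.  Hence for every \<open>P\<close> in \<open>hD0 I\<close> there is a
  polynomial \<open>g\<close> with \<open>g(0) \<noteq> 0\<close> and \<open>g P\<close> in \<open>I\<close> (lemma \<open>extension_clear_denominator\<close>).
  Multiplying \<open>P\<close> by \<open>g\<close> on the left multiplies each coefficient of \<open>P\<close> by \<open>g\<close>, without any
  commutation.  Since all \<open>u\<^sub>i\<close> are negative, every monomial of \<open>g\<close> except the constant one lowers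
  the weight, so the terms of maximal weight are only rescaled: \<open>in_w (g P) = g(0) in_w P\<close> (lemma
  \<open>in_w_mult_polynomial\<close>).  As \<open>g(0)\<close> is invertible in \<open>k\<close>, \<open>in_w P\<close> lies in the initial ideal
  of \<open>I\<close>.
\<close>

section \<open>Left ideals and their hulls\<close>

lemma left_idealD:
  assumes "left_ideal A I"
  shows "I \<subseteq> A" "0 \<in> I" "\<And>a b. a \<in> I \<Longrightarrow> b \<in> I \<Longrightarrow> a + b \<in> I"
    "\<And>r a. r \<in> A \<Longrightarrow> a \<in> I \<Longrightarrow> r * a \<in> I"
  using assms by (auto simp: left_ideal_def)

lemma subringD:
  assumes "subring R"
  shows "0 \<in> R" "1 \<in> R" "\<And>a b. a \<in> R \<Longrightarrow> b \<in> R \<Longrightarrow> a + b \<in> R"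
    "\<And>a b. a \<in> R \<Longrightarrow> b \<in> R \<Longrightarrow> a * b \<in> R"
  using assms by (auto simp: subring_def)

lemma left_ideal_self: "subring A \<Longrightarrow> left_ideal A A"
  by (auto simp: left_ideal_def subring_def)

text \<open>
  The intersection of all left ideals that contain \<open>G\<close> is one of them only if there is any, which
  is why \<open>A\<close> has to be a ring that contains \<open>G\<close>.
\<close>

lemma left_ideal_hull:
  assumes "subring A" "G \<subseteq> A"
  shows "left_ideal A (left_ideal A hull G)"
proof -
  have "left_ideal A hull G \<subseteq> A"
    using assms by (intro hull_minimal left_ideal_self)
  then show ?thesis
    unfolding left_ideal_def hull_def by blast
qed

lemma subring_hD: "subring hD"
  unfolding hD_def by (rule subring_coeffs[OF subring_polynomials deriv_polynomials])

lemma subring_hD0: "subring hD0"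
  unfolding hD0_def by (rule subring_coeffs[OF subring_local_ring deriv_local_ring])

lemma polynomials_subset_local_ring: "polynomials \<subseteq> local_ring"
  by (auto simp: polynomials_def intro!: local_ringI)

lemma hD_subset_hD0: "hD \<subseteq> hD0"
  using polynomials_subset_local_ring by (auto simp: hD_def hD0_def)


section \<open>Clearing denominators\<close>

lemma lookup_coeffs_hconst_mult:
  "Poly_Mapping.lookup (coeffs (hconst c * P)) s = c * Poly_Mapping.lookup (coeffs P) s"
proof -
  have "Poly_Mapping.lookup (Poly_Mapping.single (0, 0) c * Q) s = c * Poly_Mapping.lookup Q s"
    for Q :: "'a mono \<times> nat \<Rightarrow>\<^sub>0 ('a, 'b) ratfun"
    by (induction Q rule: poly_mapping_induct)
       (auto simp: mult_single lookup_single when_def lookup_add distrib_left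
          simp flip: zero_prod_def)
  then show ?thesis
    by (simp add: hconst_def times_hdiff.rep_eq Hdiff_inverse left_mult_single)
qed

lemma Fract_1_in_polynomials: "Fract f 1 \<in> polynomials"
  by (auto simp: polynomials_def)

lemma hconst_in_hD: "c \<in> polynomials \<Longrightarrow> hconst c \<in> hD"
  using subringD(1)[OF subring_polynomials]
  by (auto simp: hD_def hconst_def Hdiff_inverse lookup_single when_def)

lemma hconst_in_hD0: "c \<in> local_ring \<Longrightarrow> hconst c \<in> hD0"
  using subringD(1)[OF subring_local_ring]
  by (auto simp: hD0_def hconst_def Hdiff_inverse lookup_single when_def)

lemma common_denominator:
  fixes c :: "'s \<Rightarrow> ('n::{finite,linorder}, 'k::field) ratfun"
  assumes "finite S" "\<And>s. s \<in> S \<Longrightarrow> c s \<in> local_ring"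
  shows "\<exists>g. Poly_Mapping.lookup g 0 \<noteq> 0 \<and> (\<forall>s\<in>S. Fract g 1 * c s \<in> polynomials)"
  using assms
proof (induction S)
  case empty
  show ?case
    by (intro exI[of _ 1]) simp
next
  case (insert t S)
  then obtain g where g: "Poly_Mapping.lookup g 0 \<noteq> 0" "\<forall>s\<in>S. Fract g 1 * c s \<in> polynomials"
    by auto
  obtain f q where q: "c t = Fract f q" "Poly_Mapping.lookup q 0 \<noteq> 0" "q \<noteq> 0"
    using local_ringE[OF insert.prems[of t]] by blast
  have "Fract (q * g) 1 * c t = Fract (g * f) 1"
    using q by (simp add: eq_fract algebra_simps)
  moreover have "Fract (q * g) 1 * c s = Fract q 1 * (Fract g 1 * c s)" for s
    by (simp flip: mult.assoc)
  ultimately have "Fract (q * g) 1 * c s \<in> polynomials" if "s \<in> insert t S" for s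
    using that g(2) subringD(4)[OF subring_polynomials Fract_1_in_polynomials] Fract_1_in_polynomials
    by (metis insert_iff)
  then show ?case
    using g q by (intro exI[of _ "q * g"]) (simp add: lookup_mult_0)
qed

lemma hD0_clear_denominator:
  assumes "P \<in> hD0"
  shows "\<exists>g. Poly_Mapping.lookup g 0 \<noteq> 0 \<and> hconst (Fract g 1) * P \<in> hD"
proof -
  obtain g where g: "Poly_Mapping.lookup g 0 \<noteq> 0"
    "\<forall>s\<in>Poly_Mapping.keys (coeffs P). Fract g 1 * Poly_Mapping.lookup (coeffs P) s \<in> polynomials"
    using assms common_denominator[of "Poly_Mapping.keys (coeffs P)" "Poly_Mapping.lookup (coeffs P)"]
    by (auto simp: hD0_def)
  have "Fract g 1 * Poly_Mapping.lookup (coeffs P) s \<in> polynomials" for s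
    using g(2) subringD(1)[OF subring_polynomials]
    by (cases "s \<in> Poly_Mapping.keys (coeffs P)") (auto simp: in_keys_iff)
  then show ?thesis
    using g(1) by (auto simp: hD_def lookup_coeffs_hconst_mult)
qed

text \<open>
  The operators \<open>P\<close> for which such a \<open>g\<close> exists form a left ideal of \<open>hD0\<close>.  Closure under left
  multiplication by \<open>r\<close> is the Ore condition in disguise: with \<open>g P = Q\<close> in \<open>I\<close> one has
  \<open>r P = (r g\<^sup>-\<^sup>1) Q\<close>, and \<open>r g\<^sup>-\<^sup>1\<close> is again an operator over the local ring, so its
  denominators can again be cleared from the left.
\<close>

lemma extension_clear_denominator:
  fixes I :: "('n::{finite,linorder}, 'k::field) hdiff set"
  assumes I: "left_ideal hD I" and P: "P \<in> left_ideal hD0 hull I"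
  shows "\<exists>g. Poly_Mapping.lookup g 0 \<noteq> 0 \<and> hconst (Fract g 1) * P \<in> I"
proof -
  define J where
    "J = {P \<in> hD0. \<exists>g. Poly_Mapping.lookup g 0 \<noteq> 0 \<and> hconst (Fract g 1) * P \<in> I}"
  have "I \<subseteq> J"
  proof
    fix Q assume Q: "Q \<in> I"
    then have "hconst (Fract 1 1) * Q \<in> I"
      by (simp add: hconst_one flip: One_fract_def)
    then show "Q \<in> J"
      using Q left_idealD(1)[OF I] hD_subset_hD0 unfolding J_def
      by (auto intro!: exI[of _ 1])
  qed
  moreover have "left_ideal hD0 J"
    unfolding left_ideal_def
  proof (intro conjI ballI)
    show "J \<subseteq> hD0"
      by (auto simp: J_def)
    show "0 \<in> J"
      using \<open>I \<subseteq> J\<close> left_idealD(2)[OF I] by auto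
  next
    fix a b assume "a \<in> J" "b \<in> J"
    then obtain g g' where g: "Poly_Mapping.lookup g 0 \<noteq> 0" "hconst (Fract g 1) * a \<in> I"
      and g': "Poly_Mapping.lookup g' 0 \<noteq> 0" "hconst (Fract g' 1) * b \<in> I"
      and ab: "a \<in> hD0" "b \<in> hD0"
      by (auto simp: J_def)
    have "hconst (Fract (g * g') 1) * (a + b) =
        hconst (Fract g' 1) * (hconst (Fract g 1) * a) + hconst (Fract g 1) * (hconst (Fract g' 1) * b)"
      by (simp add: distrib_left mult.commute[of g' g] flip: mult.assoc hconst_mult)
    also have "\<dots> \<in> I"
      by (intro left_idealD(3)[OF I] left_idealD(4)[OF I _ g(2)] left_idealD(4)[OF I _ g'(2)]
          hconst_in_hD Fract_1_in_polynomials)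
    finally have "hconst (Fract (g * g') 1) * (a + b) \<in> I" .
    then show "a + b \<in> J"
      using g g' subringD(3)[OF subring_hD0 ab] unfolding J_def
      by (auto simp: lookup_mult_0 intro!: exI[of _ "g * g'"])
  next
    fix r a :: "('n, 'k) hdiff" assume r: "r \<in> hD0" and "a \<in> J"
    then obtain g where g: "Poly_Mapping.lookup g 0 \<noteq> 0" "hconst (Fract g 1) * a \<in> I"
      and a: "a \<in> hD0"
      by (auto simp: J_def)
    have "g \<noteq> 0"
      using g by auto
    then have one: "Fract 1 g * Fract g 1 = 1"
      by (simp add: One_fract_def eq_fract)
    have "r * hconst (Fract 1 g) \<in> hD0"
      using g by (intro subringD(4)[OF subring_hD0 r] hconst_in_hD0 local_ringI)
    then obtain g' where g': "Poly_Mapping.lookup g' 0 \<noteq> 0"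
      "hconst (Fract g' 1) * (r * hconst (Fract 1 g)) \<in> hD"
      using hD0_clear_denominator by blast
    have "a = hconst (Fract 1 g) * (hconst (Fract g 1) * a)"
      by (simp only: one hconst_one mult_1_left flip: mult.assoc hconst_mult)
    then have "hconst (Fract g' 1) * (r * a) =
        hconst (Fract g' 1) * (r * hconst (Fract 1 g)) * (hconst (Fract g 1) * a)"
      by (metis mult.assoc)
    also have "\<dots> \<in> I"
      by (rule left_idealD(4)[OF I g'(2) g(2)])
    finally have "hconst (Fract g' 1) * (r * a) \<in> I" .
    then show "r * a \<in> J"
      using g' subringD(4)[OF subring_hD0 r a] unfolding J_def by blast
  qed
  ultimately have "left_ideal hD0 hull I \<subseteq> J"
    by (rule hull_minimal)
  then show ?thesis
    using P by (auto simp: J_def)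
qed


section \<open>Initial forms under multiplication by a polynomial\<close>

lemma taylor_coeffs_mult_polynomial:
  fixes g :: "('n::{finite,linorder}, 'k::field) mpoly"
  assumes "r \<in> local_ring"
  shows "taylor_coeffs (Fract g 1 * r) = ps_mult (Poly_Mapping.lookup g) (taylor_coeffs r)"
proof -
  obtain f q where r: "r = Fract f q" and q: "Poly_Mapping.lookup q 0 \<noteq> 0"
    using assms by (rule local_ringE)
  have "ps_mult (Poly_Mapping.lookup q) (taylor_coeffs r) = Poly_Mapping.lookup f"
    using taylor_coeffs_Fract[OF q] r by blast
  then have "ps_mult (Poly_Mapping.lookup q) (ps_mult (Poly_Mapping.lookup g) (taylor_coeffs r)) =
      Poly_Mapping.lookup (g * f)"
    unfolding lookup_mult_ps by (metis ps_mult_assoc ps_mult_commute)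
  then show ?thesis
    using taylor_coeffs_Fract[OF q] by (simp add: r)
qed

lemma weight_lower_exponent:
  assumes "w \<in> W_loc" "\<mu> + \<nu> = \<alpha>" "\<nu> \<noteq> \<alpha>"
  shows "weight w (\<alpha>, \<beta>, k) < weight w (\<nu>, \<beta>, k)"
proof -
  obtain u v where w: "w = (u, v)" and u: "\<And>i. u $ i < 0"
    using assms by (auto simp: W_loc_def)
  have "\<mu> \<noteq> 0"
    using assms by auto
  then obtain i where i: "Poly_Mapping.lookup \<mu> i \<noteq> 0"
    by (metis lookup_zero poly_mapping_eqI)
  have "(\<Sum>i\<in>UNIV. u $ i * real (Poly_Mapping.lookup \<mu> i)) < (\<Sum>i\<in>(UNIV::'a set). 0)"
    using i u by (intro sum_strict_mono_ex1) (auto simp: mult_le_0_iff mult_less_0_iff less_imp_le)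
  then show ?thesis
    by (simp add: w lookup_add distrib_left sum.distrib flip: assms(2))
qed

text \<open>
  A product with \<open>g\<close> collects, at \<open>x\<^sup>\<alpha>\<close>, the coefficients of \<open>P\<close> at the divisors of \<open>x\<^sup>\<alpha>\<close>.  The
  proper divisors have larger weight, so at a monomial of weight at least \<open>ord\<^sup>w P\<close> they contribute
  nothing.
\<close>

lemma hcoeff_mult_polynomial:
  assumes w: "w \<in> W_loc" and P: "P \<in> hD0"
    and top: "\<And>t. t \<in> Supp P \<Longrightarrow> weight w t \<le> weight w s"
  shows "hcoeff (hconst (Fract g 1) * P) s = Poly_Mapping.lookup g 0 * hcoeff P s"
proof -
  obtain \<alpha> \<beta> k where s: "s = (\<alpha>, \<beta>, k)"
    by (cases s)
  have local: "Poly_Mapping.lookup (coeffs P) (\<beta>, k) \<in> local_ring"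
    using P by (auto simp: hD0_def)
  have zero: "hcoeff P (\<nu>, \<beta>, k) = 0" if "\<mu> + \<nu> = \<alpha>" "\<nu> \<noteq> \<alpha>" for \<mu> \<nu>
    using weight_lower_exponent[OF w that, of \<beta> k] top[of "(\<nu>, \<beta>, k)"] s
    by (auto simp: Supp_def)
  have "hcoeff (hconst (Fract g 1) * P) s = Poly_Mapping.lookup g 0 * hcoeff P s +
      (\<Sum>(\<mu>, \<nu>) | \<mu> + \<nu> = \<alpha> \<and> \<nu> \<noteq> \<alpha>. Poly_Mapping.lookup g \<mu> * hcoeff P (\<nu>, \<beta>, k))"
    by (simp add: s lookup_coeffs_hconst_mult taylor_coeffs_mult_polynomial[OF local]
        ps_mult_split_0)
  also have "(\<Sum>(\<mu>, \<nu>) | \<mu> + \<nu> = \<alpha> \<and> \<nu> \<noteq> \<alpha>. Poly_Mapping.lookup g \<mu> * hcoeff P (\<nu>, \<beta>, k)) = 0"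
    using zero by (intro sum.neutral) auto
  finally show ?thesis
    by simp
qed

lemma lookup_in_w:
  assumes "w \<in> W_loc"
  shows "Poly_Mapping.lookup (in_w w P) s = (if weight w s = ord_w w P then hcoeff P s else 0)"
proof -
  have "finite {t. t \<in> Supp P \<and> weight w t = ord_w w P}"
    by (rule finite_subset[OF _ finite_Supp_ge[OF assms, of P "ord_w w P"]]) auto
  then show ?thesis
    unfolding in_w_def
    by (auto simp: lookup_sum lookup_single when_def Supp_def)
qed

lemma lookup_single_zero_mult:
  fixes p :: "'a::monoid_add \<Rightarrow>\<^sub>0 'b::comm_ring_1"
  shows "Poly_Mapping.lookup (Poly_Mapping.single 0 c * p) s = c * Poly_Mapping.lookup p s"
  by (induction p rule: poly_mapping_induct)
     (auto simp: mult_single lookup_single when_def lookup_add distrib_left)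

lemma in_w_mult_polynomial:
  fixes g :: "('n::{finite,linorder}, 'k::field) mpoly"
  assumes w: "w \<in> W_loc" and P: "P \<in> hD0" and g: "Poly_Mapping.lookup g 0 \<noteq> 0"
  shows "in_w w (hconst (Fract g 1) * P) =
    Poly_Mapping.single 0 (Poly_Mapping.lookup g 0) * in_w w P"
proof (cases "Supp P = {}")
  case True
  then have "hcoeff P s = 0" for s
    unfolding Supp_def by blast
  then have "Supp (hconst (Fract g 1) * P) = {}"
    using hcoeff_mult_polynomial[OF w P, of _ g] True unfolding Supp_def
    by (metis (no_types, lifting) empty_Collect_eq empty_iff mult_zero_right)
  then show ?thesis
    using True by (simp add: in_w_def)
next
  case False
  note top = ord_w_attained[OF w False]
  let ?gP = "hconst (Fract g 1) * P"
  have coeff: "hcoeff ?gP s = Poly_Mapping.lookup g 0 * hcoeff P s"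
    if "ord_w w P \<le> weight w s" for s
    using top(2) that by (intro hcoeff_mult_polynomial[OF w P]) (blast intro: order_trans)
  have "ord_w w ?gP = ord_w w P"
    unfolding ord_w_def[of w ?gP]
  proof (rule Greatest_equality)
    show "ord_w w P \<in> weight w ` Supp ?gP"
      using top(1) coeff g by (auto simp: Supp_def)
    show "m \<le> ord_w w P" if "m \<in> weight w ` Supp ?gP" for m
    proof (rule ccontr)
      assume "\<not> m \<le> ord_w w P"
      with that obtain s where s: "s \<in> Supp ?gP" "ord_w w P < weight w s"
        by auto
      then have "s \<in> Supp P"
        using coeff[of s] by (auto simp: Supp_def)
      then show False
        using top(2)[of s] s(2) by simp
    qed
  qed
  then show ?thesis
    by (intro poly_mapping_eqI) (simp add: lookup_in_w[OF w] lookup_single_zero_mult coeff)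
qed


section \<open>Initial ideals of the extension to the local ring\<close>

lemma initial_ideal_extension:
  fixes I :: "('n::{finite,linorder}, 'k::field) hdiff set"
  assumes I: "left_ideal hD I" and w: "w \<in> W_loc"
  shows "initial_ideal w (left_ideal hD0 hull I) = initial_ideal w I"
proof
  have "left_ideal UNIV (initial_ideal w I)"
    unfolding initial_ideal_def by (rule left_ideal_hull) (auto simp: subring_def)
  moreover have "in_w w P \<in> initial_ideal w I" if P: "P \<in> left_ideal hD0 hull I" for P
  proof -
    have "I \<subseteq> hD0"
      using left_idealD(1)[OF I] hD_subset_hD0 by auto
    then have P0: "P \<in> hD0"
      using P left_idealD(1)[OF left_ideal_hull[OF subring_hD0]] by blast
    obtain g where g: "Poly_Mapping.lookup g 0 \<noteq> 0" "hconst (Fract g 1) * P \<in> I"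
      using extension_clear_denominator[OF I P] by blast
    have "in_w w (hconst (Fract g 1) * P) \<in> initial_ideal w I"
      unfolding initial_ideal_def using g by (intro hull_inc) auto
    then have "Poly_Mapping.single 0 (inverse (Poly_Mapping.lookup g 0)) *
        in_w w (hconst (Fract g 1) * P) \<in> initial_ideal w I"
      by (intro left_idealD(4)[OF \<open>left_ideal UNIV (initial_ideal w I)\<close>]) auto
    then show ?thesis
      using g(1) by (simp add: in_w_mult_polynomial[OF w P0 g(1)] mult_single flip: mult.assoc)
  qed
  ultimately show "initial_ideal w (left_ideal hD0 hull I) \<subseteq> initial_ideal w I"
    unfolding initial_ideal_def[of w "left_ideal hD0 hull I"] by (intro hull_minimal) auto
  show "initial_ideal w I \<subseteq> initial_ideal w (left_ideal hD0 hull I)"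
    unfolding initial_ideal_def by (intro hull_mono image_mono hull_subset)
qed

theorem corollary4p2p3:
  fixes I :: "('n::{finite,linorder}, 'k::field) hdiff set"
  assumes "homogeneous_ideal hD I"
  shows "weight_classes I W_loc = weight_classes (left_ideal hD0 hull I) W_loc"
proof -
  have "left_ideal hD I"
    using assms left_ideal_hull[OF subring_hD] by (auto simp: homogeneous_ideal_def)
  then have "{(w, w'). w \<in> W_loc \<and> w' \<in> W_loc \<and> initial_ideal w I = initial_ideal w' I} =
      {(w, w'). w \<in> W_loc \<and> w' \<in> W_loc \<and>
        initial_ideal w (left_ideal hD0 hull I) = initial_ideal w' (left_ideal hD0 hull I)}"
    by (auto simp: initial_ideal_extension)
  then show ?thesis
    by (simp add: weight_classes_def)
qed

end
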